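(* Let $n\ge 1$ be an integer. Suppose that $S$ and $U$ are univariate biorthogonal refinement masks, each with accuracy number at least one, and that $U$ is interpolatory. Define $n$-dimensional biorthogonal refinement masks by $$\tau:=\mathcal{C}_n[S],\qquad \tau^{\mathrm d}:=\mathcal{C}_n[U],$$ and $n$-dimensional primal wavelet masks $t_\nu$, $\nu\in\Gamma'$, by $$t_\nu(\omega)=e^{-i\omega\cdot\nu}\,\overline{U(\omega\cdot\nu+\pi)},\quad \omega\in\mathbb{T}^n.$$ Then there exist dual wavelet masks $t_\nu^{\mathrm d}$, $\nu\in\Gamma'$, such that $(\tau,(t_\nu)_{\nu\in\Gamma'})$ and $(\tau^{\mathrm d},(t^{\mathrm d}_\nu)_{\nu\in\Gamma'})$ are $n$-dimensional combined biorthogonal masks.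
   Context: Let $\Gamma=\{0,1\}^n$, $\Gamma'=\{0,1\}^n\setminus\{0\}$ (so $\#\Gamma'=2^n-1$), $\mathbb{T}^n=[-\pi,\pi]^n$. For $n=1$ these become $\{0,1\}$, $\{1\}$, $[-\pi,\pi]$. An $n$-dimensional mask is a Laurent trigonometric polynomial, i.e. a finite linear combination of the functions $\omega\mapsto e^{-ik\cdot\omega}$, $k\in\mathbb{Z}^n$ (regarded as a $2\pi$-periodic function on $\mathbb{R}^n$). A refinement mask is a mask $\tau$ with $\tau(0)=1$. "Univariate" means $n=1$. A refinement mask $\tau$ is interpolatory if $\sum_{\gamma\in\pi\Gamma}\tau(\omega+\gamma)=1$ for all $\omega\in\mathbb{T}^n$. Refinement masks $\tau$ and $\tau^{\mathrm d}$ are biorthogonal if $\sum_{\gamma\in\pi\Gamma}\overline{\tau(\omega+\gamma)}\,\tau^{\mathrm d}(\omega+\gamma)=1$ for all $\omega\in\mathbb{T}^n$ (overline is complex conjugation). The accuracy number of a refinement mask $\tau$ is the order of the zeros of $\tau$ at the points of $\pi\Gamma'$: the largest integer $m\ge 0$ such that $(D^\mu\tau)(\gamma)=0$ for all $\gamma\in\pi\Gamma'$ and all multi-indices $\mu\in\mathbb{N}_0^n$ with $\mu_1+\cdots+\mu_n\le m-1$. In particular a univariate refinement mask $R$ has accuracy number at least one iff $R(\pi)=0$. The coset sum $\mathcal{C}_n$ maps a univariate refinement mask $R$ to the $n$-dimensional refinement mask $$\mathcal{C}_n[R](\omega)=\frac{1}{2^{n-1}}\Big(1-2^{n-1}+\sum_{\nu\in\Gamma'}R(\omega\cdot\nu)\Big),\quad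 \omega\in\mathbb{T}^n,$$ where $\omega\cdot\nu$ is the standard inner product. Given biorthogonal refinement masks $(\tau,\tau^{\mathrm d})$ and Laurent trigonometric polynomials $t_\nu,t_\nu^{\mathrm d}$, $\nu\in\Gamma'$, the families $(\tau,(t_\nu)_{\nu\in\Gamma'})$ and $(\tau^{\mathrm d},(t^{\mathrm d}_\nu)_{\nu\in\Gamma'})$ are called combined biorthogonal masks (and $t_\nu$, $t_\nu^{\mathrm d}$ are called primal and dual wavelet masks) if the Mixed Unitary Extension Principle conditions hold: for every $\omega\in\mathbb{T}^n$ and every $\gamma\in\pi\Gamma$, $$\overline{\tau(\omega+\gamma)}\,\tau^{\mathrm d}(\omega)+\sum_{\nu\in\Gamma'}\overline{t_\nu(\omega+\gamma)}\,t^{\mathrm d}_\nu(\omega)=\begin{cases}1,&\gamma=0,\\ 0,&\gamma\in\pi\Gamma'.\end{cases}$$ *)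

theory Defs
  imports "HOL-Analysis.Analysis"
begin

text \<open>
  All notions are defined over an arbitrary Euclidean space, so that the \<open>n\<close>-dimensional case is
  the type \<open>real ^ 'n\<close> and the univariate case is the type \<open>real\<close>, whose basis is \<open>{1}\<close> and
  whose inner product is multiplication. The coordinates of \<open>x\<close> are \<open>x \<bullet> b\<close> for \<open>b \<in> Basis\<close>.
\<close>

definition int_lattice :: "'a::euclidean_space set" where
  "int_lattice = {k. \<forall>b\<in>Basis. k \<bullet> b \<in> \<int>}"

definition Gam :: "'a::euclidean_space set" where
  "Gam = {x. \<forall>b\<in>Basis. x \<bullet> b \<in> {0, 1}}"

definition Gam' :: "'a::euclidean_space set" where
  "Gam' = Gam - {0}"

definition torus :: "'a::euclidean_space set" where
  "torus = {x. \<forall>b\<in>Basis. x \<bullet> b \<in> {-pi..pi}}"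

definition mask :: "('a::euclidean_space \<Rightarrow> complex) \<Rightarrow> bool" where
  "mask \<tau> \<longleftrightarrow> (\<exists>K c. finite K \<and> K \<subseteq> int_lattice \<and>
     \<tau> = (\<lambda>\<omega>. \<Sum>k\<in>K. c k * exp (- \<i> * complex_of_real (k \<bullet> \<omega>))))"

definition refinement_mask :: "('a::euclidean_space \<Rightarrow> complex) \<Rightarrow> bool" where
  "refinement_mask \<tau> \<longleftrightarrow> mask \<tau> \<and> \<tau> 0 = 1"

definition interpolatory :: "('a::euclidean_space \<Rightarrow> complex) \<Rightarrow> bool" where
  "interpolatory \<tau> \<longleftrightarrow> refinement_mask \<tau> \<and>
     (\<forall>\<omega>\<in>torus. (\<Sum>\<gamma>\<in>(*\<^sub>R) pi ` Gam. \<tau> (\<omega> + \<gamma>)) = 1)"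

definition biorthogonal ::
    "('a::euclidean_space \<Rightarrow> complex) \<Rightarrow> ('a \<Rightarrow> complex) \<Rightarrow> bool" where
  "biorthogonal \<tau> \<tau>d \<longleftrightarrow> refinement_mask \<tau> \<and> refinement_mask \<tau>d \<and>
     (\<forall>\<omega>\<in>torus. (\<Sum>\<gamma>\<in>(*\<^sub>R) pi ` Gam. cnj (\<tau> (\<omega> + \<gamma>)) * \<tau>d (\<omega> + \<gamma>)) = 1)"

definition partial_deriv ::
    "'a::euclidean_space \<Rightarrow> ('a \<Rightarrow> complex) \<Rightarrow> 'a \<Rightarrow> complex" where
  "partial_deriv b f x = vector_derivative (\<lambda>t. f (x + t *\<^sub>R b)) (at 0)"

text \<open>
  A multi-index assigns a natural number to each basis vector; its values off \<open>Basis\<close> play no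
  role. The coordinate directions are processed in some fixed order, which does not matter for
  smooth functions, in particular for masks.
\<close>

definition basis_enum :: "'a::euclidean_space list" where
  "basis_enum = (SOME bs. distinct bs \<and> set bs = Basis)"

definition multi_deriv ::
    "('a::euclidean_space \<Rightarrow> nat) \<Rightarrow> ('a \<Rightarrow> complex) \<Rightarrow> 'a \<Rightarrow> complex" where
  "multi_deriv \<mu> f = foldr (\<lambda>b. partial_deriv b ^^ \<mu> b) basis_enum f"

definition vanishes_to_order :: "nat \<Rightarrow> ('a::euclidean_space \<Rightarrow> complex) \<Rightarrow> bool" where
  "vanishes_to_order m \<tau> \<longleftrightarrow>
     (\<forall>\<gamma>\<in>(*\<^sub>R) pi ` Gam'. \<forall>\<mu>. (\<Sum>b\<in>Basis. \<mu> b) < m \<longrightarrow> multi_deriv \<mu> \<tau> \<gamma> = 0)"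

text \<open>
  For a refinement mask the supremum below is a maximum: a mask vanishing to infinite order at
  some point is identically zero, contradicting \<open>\<tau> 0 = 1\<close>.
\<close>

definition accuracy_number :: "('a::euclidean_space \<Rightarrow> complex) \<Rightarrow> enat" where
  "accuracy_number \<tau> = (SUP m \<in> {m. vanishes_to_order m \<tau>}. enat m)"

definition coset_sum :: "(real \<Rightarrow> complex) \<Rightarrow> 'a::euclidean_space \<Rightarrow> complex" where
  "coset_sum R \<omega> =
     1 / 2 ^ (DIM('a) - 1) * (1 - 2 ^ (DIM('a) - 1) + (\<Sum>\<nu>\<in>Gam'. R (\<omega> \<bullet> \<nu>)))"

text \<open>
  A family of wavelet masks indexed by \<open>Gam'\<close> is a function whose values off \<open>Gam'\<close> play no role.
\<close>

definition combined_biorthogonal_masks ::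
    "('a::euclidean_space \<Rightarrow> complex) \<Rightarrow> ('a \<Rightarrow> 'a \<Rightarrow> complex) \<Rightarrow>
     ('a \<Rightarrow> complex) \<Rightarrow> ('a \<Rightarrow> 'a \<Rightarrow> complex) \<Rightarrow> bool" where
  "combined_biorthogonal_masks \<tau> t \<tau>d td \<longleftrightarrow>
     biorthogonal \<tau> \<tau>d \<and> (\<forall>\<nu>\<in>Gam'. mask (t \<nu>) \<and> mask (td \<nu>)) \<and>
     (\<forall>\<omega>\<in>torus. \<forall>\<gamma>\<in>(*\<^sub>R) pi ` Gam.
        cnj (\<tau> (\<omega> + \<gamma>)) * \<tau>d \<omega> + (\<Sum>\<nu>\<in>Gam'. cnj (t \<nu> (\<omega> + \<gamma>)) * td \<nu> \<omega>)
          = (if \<gamma> = 0 then 1 else 0))"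

lemma finite_Gam: "finite (Gam :: 'a::euclidean_space set)"
proof -
  let ?f = "\<lambda>x::'a. \<lambda>b\<in>Basis. x \<bullet> b"
  have "?f ` Gam \<subseteq> Basis \<rightarrow>\<^sub>E {0, 1}"
    by (auto simp: Gam_def)
  moreover have "finite (Basis \<rightarrow>\<^sub>E {0, 1::real} :: ('a \<Rightarrow> real) set)"
    by (intro finite_PiE) auto
  moreover have "inj_on ?f Gam"
  proof (rule inj_onI)
    fix x y :: 'a
    assume "?f x = ?f y"
    then have "x \<bullet> b = y \<bullet> b" if "b \<in> Basis" for b
      using that by (metis restrict_apply')
    then show "x = y"
      by (rule euclidean_eqI)
  qed
  ultimately show ?thesis
    by (meson finite_subset finite_imageD)
qed

lemma Gam_real: "(Gam :: real set) = {0, 1}"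
  by (auto simp: Gam_def)

lemma Gam'_real: "(Gam' :: real set) = {1}"
  by (auto simp: Gam'_def Gam_real)

lemma torus_real: "(torus :: real set) = {-pi..pi}"
  by (auto simp: torus_def)

lemma coset_sum_real: "coset_sum R = R"
  by (rule ext) (simp add: coset_sum_def Gam'_real)

lemma basis_enum_real: "(basis_enum :: real list) = [1]"
proof -
  define bs :: "real list" where "bs = basis_enum"
  have "distinct bs \<and> set bs = Basis"
    unfolding bs_def basis_enum_def
    by (rule someI_ex) (metis finite_Basis finite_distinct_list)
  then have "length bs = 1" "set bs = {1}"
    using distinct_card[of bs] by auto
  then have "bs = [1]"
    by (cases bs) auto
  then show ?thesis
    by (simp add: bs_def)
qed

lemma one_le_accuracy_number_real:
  fixes R :: "real \<Rightarrow> complex"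
  shows "1 \<le> accuracy_number R \<longleftrightarrow> R pi = 0"
proof
  assume "R pi = 0"
  then have "vanishes_to_order 1 R"
    by (simp add: vanishes_to_order_def Gam'_real multi_deriv_def basis_enum_real)
  then have "enat 1 \<le> accuracy_number R"
    unfolding accuracy_number_def by (intro SUP_upper) simp
  then show "1 \<le> accuracy_number R"
    by (simp add: one_enat_def)
next
  assume *: "1 \<le> accuracy_number R"
  have "\<exists>m\<ge>1. vanishes_to_order m R"
  proof (rule ccontr)
    assume "\<not> ?thesis"
    then have "m = 0" if "vanishes_to_order m R" for m
      using that by (cases m) auto
    then have "accuracy_number R \<le> 0"
      unfolding accuracy_number_def by (intro SUP_least) (auto simp: zero_enat_def)
    with * show False
      by simp
  qed
  then obtain m where m: "m \<ge> 1" "vanishes_to_order m R"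
    by blast
  then have "multi_deriv (\<lambda>_. 0) R pi = 0"
    unfolding vanishes_to_order_def Gam'_real by (auto dest!: spec[of _ "\<lambda>_. 0"])
  then show "R pi = 0"
    by (simp add: multi_deriv_def basis_enum_real)
qed

end

theory Submission
  imports Defs
begin

text \<open>
  Split a univariate mask into its parts \<open>even_part\<close> and \<open>odd_part\<close>, which are multiplied by
  \<open>1\<close> and \<open>-1\<close> under the shift by \<open>\<pi>\<close>. Shifting \<open>\<omega> \<mapsto> R (\<omega> \<bullet> \<nu>)\<close> by \<open>\<pi> g\<close> then multiplies its odd
  part by the character \<open>(-1)\<^bsup>\<nu> \<bullet> g\<^esup>\<close>, so a coset sum is an expansion in the characters of
  \<open>(\<int>/2)\<^sup>n\<close>. Biorthogonality of the coset sums is Parseval's identity for these characters.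
  Since the even part of an interpolatory mask is \<open>1/2\<close>, comparing the coefficient of the character
  of \<open>\<nu>\<close> in the extension principle determines the dual wavelet mask to be
  \<open>2\<^bsup>1 - n\<^esup> e\<^bsup>-i \<omega> \<bullet> \<nu>\<^esup> (1 - (cnj (S (\<omega> \<bullet> \<nu>)) - cnj (S (\<omega> \<bullet> \<nu> + \<pi>))) \<tau>d \<omega>)\<close>; the coefficient of the
  trivial character then agrees as well, because \<open>S\<close> and \<open>U\<close> are biorthogonal.
\<close>

section \<open>The algebra of masks\<close>

lemma int_lattice_add: "k \<in> int_lattice \<Longrightarrow> l \<in> int_lattice \<Longrightarrow> k + l \<in> int_lattice"
  by (simp add: int_lattice_def inner_add_left)

lemma int_lattice_minus: "k \<in> int_lattice \<Longrightarrow> - k \<in> int_lattice"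
  by (simp add: int_lattice_def)

lemma zero_in_int_lattice: "0 \<in> int_lattice"
  by (simp add: int_lattice_def)

lemma Gam_subset_int_lattice: "Gam \<subseteq> int_lattice"
  by (force simp: Gam_def int_lattice_def)

lemma inner_int_lattice:
  assumes "k \<in> int_lattice" "l \<in> int_lattice"
  shows "k \<bullet> l \<in> \<int>"
  unfolding euclidean_inner[of k l]
  using assms by (intro Ints_sum Ints_mult) (auto simp: int_lattice_def)

lemma mask_monomial:
  assumes "k \<in> int_lattice"
  shows "mask (\<lambda>\<omega>. c * exp (- \<i> * complex_of_real (k \<bullet> \<omega>)))"
  unfolding mask_def using assms by (intro exI[of _ "{k}"] exI[of _ "\<lambda>_. c"]) simp

lemma mask_const: "mask (\<lambda>_. c)"
  using mask_monomial[OF zero_in_int_lattice, of c] by simp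

lemma mask_add:
  assumes "mask f" "mask g"
  shows "mask (\<lambda>\<omega>. f \<omega> + g \<omega>)"
proof -
  obtain K c where K: "finite K" "K \<subseteq> int_lattice"
    and f: "f = (\<lambda>\<omega>. \<Sum>k\<in>K. c k * exp (- \<i> * complex_of_real (k \<bullet> \<omega>)))"
    using assms(1) unfolding mask_def by blast
  obtain L d where L: "finite L" "L \<subseteq> int_lattice"
    and g: "g = (\<lambda>\<omega>. \<Sum>k\<in>L. d k * exp (- \<i> * complex_of_real (k \<bullet> \<omega>)))"
    using assms(2) unfolding mask_def by blast
  \<comment> \<open>Both coefficient functions are extended by zero to the common frequency set, so
    that shared frequencies add up.\<close>
  let ?c = "\<lambda>k. (if k \<in> K then c k else 0) + (if k \<in> L then d k else 0)"
  have "f \<omega> + g \<omega> = (\<Sum>k\<in>K \<union> L. ?c k * exp (- \<i> * complex_of_real (k \<bullet> \<omega>)))" for \<omega>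
  proof -
    have "f \<omega> = (\<Sum>k\<in>K \<union> L. (if k \<in> K then c k else 0) * exp (- \<i> * complex_of_real (k \<bullet> \<omega>)))"
      unfolding f using K L by (intro sum.mono_neutral_cong_left) auto
    moreover have "g \<omega> =
        (\<Sum>k\<in>K \<union> L. (if k \<in> L then d k else 0) * exp (- \<i> * complex_of_real (k \<bullet> \<omega>)))"
      unfolding g using K L by (intro sum.mono_neutral_cong_left) auto
    ultimately show ?thesis
      by (simp add: sum.distrib[symmetric] ring_distribs(2))
  qed
  then show ?thesis
    unfolding mask_def using K L by (intro exI[of _ "K \<union> L"] exI[of _ ?c]) auto
qed

lemma mask_sum:
  assumes "\<And>i. i \<in> I \<Longrightarrow> mask (f i)"
  shows "mask (\<lambda>\<omega>. \<Sum>i\<in>I. f i \<omega>)"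
  using assms
  by (induction I rule: infinite_finite_induct) (auto intro: mask_add mask_const)

text \<open>Closure properties that commute with finite sums need checking on monomials only. The
  index set is a set of frequencies, hence of type \<open>'a set\<close>.\<close>

lemma mask_induct [consumes 1, case_names monomial sum]:
  assumes "mask f"
    and "\<And>c k. k \<in> int_lattice \<Longrightarrow> P (\<lambda>\<omega>. c * exp (- \<i> * complex_of_real (k \<bullet> \<omega>)))"
    and "\<And>(I :: 'a set) f. finite I \<Longrightarrow> (\<And>i. i \<in> I \<Longrightarrow> P (f i)) \<Longrightarrow> P (\<lambda>\<omega>. \<Sum>i\<in>I. f i \<omega>)"
  shows "P (f :: 'a::euclidean_space \<Rightarrow> complex)"
  using assms unfolding mask_def by (auto intro!: assms(3) assms(2))

text \<open>Frequencies of monomials add. Fixing one monomial factor lets \<open>mask_mult\<close>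
  run a second induction over the other factor.\<close>

lemma mask_mult_monomial:
  assumes "mask f" "l \<in> int_lattice"
  shows "mask (\<lambda>\<omega>. d * exp (- \<i> * complex_of_real (l \<bullet> \<omega>)) * f \<omega>)"
  using assms(1)
proof (induction rule: mask_induct)
  case (monomial c k)
  have "(\<lambda>\<omega>. d * exp (- \<i> * complex_of_real (l \<bullet> \<omega>)) * (c * exp (- \<i> * complex_of_real (k \<bullet> \<omega>)))) =
      (\<lambda>\<omega>. d * c * exp (- \<i> * complex_of_real ((l + k) \<bullet> \<omega>)))"
    by (simp add: inner_add_left exp_add ring_distribs exp_diff exp_minus field_simps)
  then show ?case
    using mask_monomial[OF int_lattice_add[OF assms(2) monomial], of "d * c"] by simp
next
  case (sum I f)
  then show ?case
    by (simp add: sum_distrib_left mask_sum)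
qed

lemma mask_mult:
  assumes "mask f" "mask g"
  shows "mask (\<lambda>\<omega>. f \<omega> * g \<omega>)"
  using assms(1)
proof (induction rule: mask_induct)
  case (monomial c k)
  then show ?case
    using mask_mult_monomial[OF assms(2)] by blast
next
  case (sum I f)
  then show ?case
    by (simp add: sum_distrib_right mask_sum)
qed

lemma mask_diff:
  assumes "mask f" "mask g"
  shows "mask (\<lambda>\<omega>. f \<omega> - g \<omega>)"
  using mask_add[OF assms(1) mask_mult[OF mask_const[of "- 1"] assms(2)]] by simp

lemma mask_cnj:
  assumes "mask f"
  shows "mask (\<lambda>\<omega>. cnj (f \<omega>))"
  using assms
proof (induction rule: mask_induct)
  case (monomial c k)
  then show ?case
    using mask_monomial[OF int_lattice_minus[OF monomial], of "cnj c"] by (simp add: exp_cnj)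
next
  case (sum I f)
  then show ?case
    by (simp add: cnj_sum mask_sum)
qed

text \<open>A translation leaves the frequencies alone and only multiplies the coefficient at
  \<open>k\<close> by a constant depending on \<open>k \<bullet> a\<close>.\<close>

lemma mask_shift:
  assumes "mask f"
  shows "mask (\<lambda>\<omega>. f (\<omega> + a))"
  using assms
proof (induction rule: mask_induct)
  case (monomial c k)
  have "(\<lambda>\<omega>. c * exp (- \<i> * complex_of_real (k \<bullet> (\<omega> + a)))) =
      (\<lambda>\<omega>. c * exp (- \<i> * complex_of_real (k \<bullet> a)) * exp (- \<i> * complex_of_real (k \<bullet> \<omega>)))"
    by (simp add: inner_add_right ring_distribs exp_diff exp_minus field_simps)
  then show ?case
    using mask_monomial[OF monomial] by simp
next
  case (sum I f)
  then show ?case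
    by (simp add: mask_sum)
qed

lemma mask_ridge:
  fixes f :: "real \<Rightarrow> complex"
  assumes "mask f" "\<nu> \<in> int_lattice"
  shows "mask (\<lambda>\<omega>. f (\<omega> \<bullet> \<nu>))"
  using assms(1)
proof (induction rule: mask_induct)
  case (monomial c k)
  have "k *\<^sub>R \<nu> \<in> int_lattice"
    using assms(2) monomial by (auto simp: int_lattice_def)
  from mask_monomial[OF this, of c] show ?case
    by (simp add: inner_commute mult.commute)
next
  case (sum I f)
  then show ?case
    by (simp add: mask_sum)
qed

text \<open>Since \<open>k \<bullet> l\<close> is an integer, each exponent changes by an integer
  multiple of \<open>2 * pi * \<i>\<close>.\<close>

lemma mask_periodic:
  assumes "mask f" "l \<in> int_lattice"
  shows "f (\<omega> + (2 * pi) *\<^sub>R l) = f \<omega>"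
  using assms(1)
proof (induction rule: mask_induct)
  case (monomial c k)
  have "k \<bullet> l \<in> \<int>"
    using inner_int_lattice monomial assms(2) by blast
  then obtain j where j: "k \<bullet> l = real_of_int j"
    by (auto elim: Ints_cases)
  have "- \<i> * complex_of_real (k \<bullet> (\<omega> + (2 * pi) *\<^sub>R l)) =
      - \<i> * complex_of_real (k \<bullet> \<omega>) + \<i> * (of_int (- j) * (of_real pi * 2))"
    by (simp add: inner_add_right j algebra_simps)
  then show ?case
    by (simp only: exp_plus_2pin)
next
  case (sum I f)
  then show ?case
    by simp
qed

lemma mask_periodic_real:
  fixes f :: "real \<Rightarrow> complex"
  assumes "mask f"
  shows "f (x + 2 * pi * of_int j) = f x"
  using mask_periodic[OF assms, of "of_int j"] by (simp add: int_lattice_def)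

section \<open>Characters of the discrete cube\<close>

text \<open>On lattice vectors this is the sign (-1) to the power \<open>\<nu> \<bullet> g\<close>.
  The cosine makes sense for real inner products and shows at once that the value is real and
  symmetric in both arguments.\<close>

definition cube_char :: "'a::euclidean_space \<Rightarrow> 'a \<Rightarrow> complex" where
  "cube_char \<nu> g = complex_of_real (cos (pi * (\<nu> \<bullet> g)))"

lemma zero_in_Gam: "0 \<in> Gam"
  by (simp add: Gam_def)

lemma finite_Gam': "finite Gam'"
  by (simp add: Gam'_def finite_Gam)

lemma Gam_eq_insert: "Gam = insert 0 Gam'"
  using zero_in_Gam by (auto simp: Gam'_def)

lemma zero_notin_Gam': "0 \<notin> Gam'"
  by (simp add: Gam'_def)

text \<open>A vertex of the cube is the indicator vector of a set of basis vectors.\<close>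

lemma card_Gam: "card (Gam :: 'a::euclidean_space set) = 2 ^ DIM('a)"
proof -
  have "bij_betw (\<lambda>x::'a. {b\<in>Basis. x \<bullet> b = 1}) Gam (Pow Basis)"
  proof (rule bij_betwI[where g = "\<lambda>B. \<Sum>b\<in>Basis. (if b \<in> B then 1 else 0) *\<^sub>R b"])
    show "(\<lambda>B. \<Sum>b\<in>Basis. (if b \<in> B then 1 else 0) *\<^sub>R b) \<in> Pow Basis \<rightarrow> (Gam :: 'a set)"
      by (auto simp: Gam_def)
    show "(\<Sum>b\<in>Basis. (if b \<in> {b\<in>Basis. x \<bullet> b = 1} then 1 else 0) *\<^sub>R b) = x"
      if "x \<in> Gam" for x :: 'a
      using that by (intro euclidean_eqI[where 'a='a]) (auto simp: Gam_def)
    show "{b\<in>Basis. (\<Sum>b\<in>Basis. (if b \<in> B then 1 else 0) *\<^sub>R b) \<bullet> b = 1} = B"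
      if "B \<in> Pow Basis" for B :: "'a set"
      using that by (auto split: if_splits)
  qed auto
  then show ?thesis
    by (simp add: bij_betw_same_card card_Pow)
qed

text \<open>Links the size of the cube to the normalisation of coset sums. The truncated subtraction
  is exact because the dimension is positive.\<close>

lemma two_power_DIM: "(2::'b::semiring_1) ^ DIM('a::euclidean_space) = 2 * 2 ^ (DIM('a) - 1)"
  using power_Suc[of "2::'b" "DIM('a) - 1"] by simp

lemma card_Gam': "complex_of_nat (card (Gam' :: 'a::euclidean_space set)) = 2 * 2 ^ (DIM('a) - 1) - 1"
proof -
  have "Suc (card (Gam' :: 'a set)) = 2 ^ DIM('a)"
    unfolding card_Gam[symmetric] Gam_eq_insert by (simp add: finite_Gam' zero_notin_Gam')
  then have "of_nat (Suc (card (Gam' :: 'a set))) = (2 ^ DIM('a) :: complex)"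
    by (metis of_nat_numeral of_nat_power)
  then show ?thesis
    by (simp add: two_power_DIM algebra_simps)
qed

lemma cos_pi_times_add_odd:
  assumes "d = 1 \<or> d = -1"
  shows "cos (pi * (x + d)) = - cos (pi * x)"
  using assms by (auto simp: ring_distribs cos_diff cos_add)

lemma cube_char_commute: "cube_char \<nu> g = cube_char g \<nu>"
  by (simp add: cube_char_def inner_commute)

lemma cube_char_zero: "cube_char 0 g = 1"
  by (simp add: cube_char_def)

lemma cube_char_square:
  assumes "\<nu> \<in> Gam" "g \<in> Gam"
  shows "cube_char \<nu> g * cube_char \<nu> g = 1"
proof -
  have "\<nu> \<bullet> g \<in> \<int>"
    using assms inner_int_lattice Gam_subset_int_lattice by blast
  then obtain j where "\<nu> \<bullet> g = of_int j"
    by (auto elim: Ints_cases)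
  then have "cos (pi * (\<nu> \<bullet> g)) = 1 \<or> cos (pi * (\<nu> \<bullet> g)) = -1"
    using cos_npi_int[of j] by (auto split: if_splits)
  then show ?thesis
    by (auto simp: cube_char_def)
qed

text \<open>If \<open>\<nu>\<close> and \<open>\<mu>\<close> differ in the coordinate
  \<open>b\<close>, flipping that coordinate of \<open>g\<close> is an involution of the cube that
  negates every term, so the sum equals its own negative.\<close>

lemma cube_char_orthogonal:
  fixes \<nu> \<mu> :: "'a::euclidean_space"
  assumes "\<nu> \<in> Gam" "\<mu> \<in> Gam"
  shows "(\<Sum>g\<in>Gam. cube_char \<nu> g * cube_char \<mu> g) = (if \<nu> = \<mu> then 2 ^ DIM('a) else 0)"
proof (cases "\<nu> = \<mu>")
  case True
  then show ?thesis
    using assms by (simp add: cube_char_square card_Gam)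
next
  case False
  then obtain b :: 'a where b: "b \<in> Basis" "\<nu> \<bullet> b \<noteq> \<mu> \<bullet> b"
    using euclidean_eqI by blast
  \<comment> \<open>The factor \<open>1 - 2 * (g \<bullet> b)\<close> is 1 at coordinate 0 and -1 at
    coordinate 1.\<close>
  let ?flip = "\<lambda>g. g + (1 - 2 * (g \<bullet> b)) *\<^sub>R b"
  have flip_Gam: "?flip g \<in> Gam" if "g \<in> Gam" for g
    using that b(1) by (auto simp: Gam_def inner_add_left inner_Basis)
  have flip_flip: "?flip (?flip g) = g" for g
    using b(1) by (simp add: inner_add_left algebra_simps)
  have sign: "cube_char \<nu> (?flip g) * cube_char \<mu> (?flip g) = - (cube_char \<nu> g * cube_char \<mu> g)"
    if "g \<in> Gam" for g
  proof -
    have d: "1 - 2 * (g \<bullet> b) = 1 \<or> 1 - 2 * (g \<bullet> b) = -1"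
      using that b(1) by (auto simp: Gam_def)
    have "\<nu> \<bullet> b \<in> {0, 1}" "\<mu> \<bullet> b \<in> {0, 1}"
      using assms b(1) unfolding Gam_def by blast+
    then have "\<nu> \<bullet> b = 0 \<and> \<mu> \<bullet> b = 1 \<or> \<nu> \<bullet> b = 1 \<and> \<mu> \<bullet> b = 0"
      using b(2) by auto
    then show ?thesis
      by (auto simp: cube_char_def inner_add_right cos_pi_times_add_odd[OF d])
  qed
  have "(\<Sum>g\<in>Gam. cube_char \<nu> g * cube_char \<mu> g) =
      (\<Sum>g\<in>Gam. cube_char \<nu> (?flip g) * cube_char \<mu> (?flip g))"
    by (rule sum.reindex_bij_witness[of _ ?flip ?flip]) (simp_all only: flip_Gam flip_flip)
  also have "\<dots> = - (\<Sum>g\<in>Gam. cube_char \<nu> g * cube_char \<mu> g)"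
    by (simp only: sign sum_negf[symmetric] cong: sum.cong)
  finally show ?thesis
    using False by simp
qed

lemma sum_cube_char:
  fixes g :: "'a::euclidean_space"
  assumes "g \<in> Gam"
  shows "1 + (\<Sum>\<nu>\<in>Gam'. cube_char \<nu> g) = (if g = 0 then 2 ^ DIM('a) else 0)"
proof -
  have "(\<Sum>\<nu>\<in>Gam. cube_char \<nu> g) = (if g = 0 then 2 ^ DIM('a) else 0)"
    using cube_char_orthogonal[OF assms zero_in_Gam]
    by (simp add: cube_char_commute[of g] cube_char_zero)
  then show ?thesis
    unfolding Gam_eq_insert
    by (simp add: finite_Gam' zero_notin_Gam' cube_char_zero)
qed

text \<open>Summing over \<open>g\<close> first leaves only the diagonal terms, by orthogonality.
  The characters are real, so a bilinear form without conjugation is enough.\<close>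

lemma parseval_cube:
  fixes x y :: "'a::euclidean_space \<Rightarrow> complex"
  shows "(\<Sum>g\<in>Gam. (\<Sum>\<nu>\<in>Gam. cube_char \<nu> g * x \<nu>) * (\<Sum>\<mu>\<in>Gam. cube_char \<mu> g * y \<mu>)) =
    2 ^ DIM('a) * (\<Sum>\<nu>\<in>Gam. x \<nu> * y \<nu>)"
proof -
  have "(\<Sum>g\<in>Gam. (\<Sum>\<nu>\<in>Gam. cube_char \<nu> g * x \<nu>) * (\<Sum>\<mu>\<in>Gam. cube_char \<mu> g * y \<mu>)) =
      (\<Sum>g\<in>Gam. \<Sum>\<nu>\<in>Gam. \<Sum>\<mu>\<in>Gam. x \<nu> * y \<mu> * (cube_char \<nu> g * cube_char \<mu> g))"
    by (simp add: sum_product mult_ac)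
  also have "\<dots> = (\<Sum>\<nu>\<in>Gam. \<Sum>\<mu>\<in>Gam. \<Sum>g\<in>Gam. x \<nu> * y \<mu> * (cube_char \<nu> g * cube_char \<mu> g))"
    by (subst sum.swap, rule sum.cong[OF refl], rule sum.swap)
  also have "\<dots> = (\<Sum>\<nu>\<in>Gam. \<Sum>\<mu>\<in>Gam. x \<nu> * y \<mu> * (if \<nu> = \<mu> then 2 ^ DIM('a) else 0))"
    by (simp add: sum_distrib_left[symmetric] cube_char_orthogonal cong: sum.cong)
  also have "\<dots> = (\<Sum>\<nu>\<in>Gam. 2 ^ DIM('a) * (x \<nu> * y \<nu>))"
    by (intro sum.cong refl) (simp add: if_distrib finite_Gam mult_ac cong: if_cong)
  finally show ?thesis
    by (simp add: sum_distrib_left)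
qed

text \<open>Coset sums come with a separate constant, which is the coefficient of the trivial
  character; overriding \<open>x\<close> and \<open>y\<close> at 0 puts it back.\<close>

lemma parseval_cube_split:
  fixes x y :: "'a::euclidean_space \<Rightarrow> complex"
  shows "(\<Sum>g\<in>Gam. (c + (\<Sum>\<nu>\<in>Gam'. cube_char \<nu> g * x \<nu>)) * (d + (\<Sum>\<nu>\<in>Gam'. cube_char \<nu> g * y \<nu>))) =
    2 ^ DIM('a) * (c * d + (\<Sum>\<nu>\<in>Gam'. x \<nu> * y \<nu>))"
proof -
  have upd: "(\<Sum>\<nu>\<in>Gam. h \<nu> * (z(0 := e)) \<nu>) = h 0 * e + (\<Sum>\<nu>\<in>Gam'. h \<nu> * z \<nu>)"
    for h z :: "'a \<Rightarrow> complex" and e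
    unfolding Gam_eq_insert
    by (simp add: finite_Gam' zero_notin_Gam', rule sum.cong) (auto simp: zero_notin_Gam')
  have upd': "(\<Sum>\<nu>\<in>Gam. (x(0 := c)) \<nu> * (y(0 := d)) \<nu>) = c * d + (\<Sum>\<nu>\<in>Gam'. x \<nu> * y \<nu>)"
    unfolding upd using zero_notin_Gam' by (auto intro!: sum.cong)
  show ?thesis
    using parseval_cube[of "x(0 := c)" "y(0 := d)"]
    unfolding upd' unfolding upd by (simp add: cube_char_zero)
qed

section \<open>Coset sums\<close>

definition even_part :: "(real \<Rightarrow> complex) \<Rightarrow> real \<Rightarrow> complex" where
  "even_part R x = (R x + R (x + pi)) / 2"

definition odd_part :: "(real \<Rightarrow> complex) \<Rightarrow> real \<Rightarrow> complex" where
  "odd_part R x = (R x - R (x + pi)) / 2"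

text \<open>The argument moves by an integer multiple of \<open>pi\<close>, and by periodicity only
  the parity of that integer matters; the character records it.\<close>

lemma mask_ridge_shift:
  fixes R :: "real \<Rightarrow> complex"
  assumes "mask R" "\<nu> \<in> Gam" "g \<in> Gam"
  shows "R ((\<omega> + pi *\<^sub>R g) \<bullet> \<nu>) = even_part R (\<omega> \<bullet> \<nu>) + cube_char \<nu> g * odd_part R (\<omega> \<bullet> \<nu>)"
proof -
  have "\<nu> \<bullet> g \<in> \<int>"
    using assms inner_int_lattice Gam_subset_int_lattice by blast
  then obtain j where j: "\<nu> \<bullet> g = of_int j"
    by (auto elim: Ints_cases)
  have arg: "(\<omega> + pi *\<^sub>R g) \<bullet> \<nu> = \<omega> \<bullet> \<nu> + pi * of_int j"
    by (simp add: inner_add_left inner_commute[of g] j)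
  have char: "cube_char \<nu> g = (if even j then 1 else -1)"
    using cos_npi_int[of j] by (simp add: cube_char_def j)
  show ?thesis
  proof (cases "even j")
    case True
    then obtain i where "j = 2 * i"
      by blast
    then have "\<omega> \<bullet> \<nu> + pi * of_int j = \<omega> \<bullet> \<nu> + 2 * pi * of_int i"
      by simp
    then have "R (\<omega> \<bullet> \<nu> + pi * of_int j) = R (\<omega> \<bullet> \<nu>)"
      using mask_periodic_real[OF assms(1)] by metis
    then show ?thesis
      using True by (simp add: arg char even_part_def odd_part_def field_simps)
  next
    case False
    then obtain i where "j = 2 * i + 1"
      by (auto elim: oddE)
    then have "\<omega> \<bullet> \<nu> + pi * of_int j = (\<omega> \<bullet> \<nu> + pi) + 2 * pi * of_int i"
      by (simp add: algebra_simps)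
    then have "R (\<omega> \<bullet> \<nu> + pi * of_int j) = R (\<omega> \<bullet> \<nu> + pi)"
      using mask_periodic_real[OF assms(1)] by metis
    then show ?thesis
      using False by (simp add: arg char even_part_def odd_part_def field_simps)
  qed
qed

text \<open>As a function of \<open>g\<close> this is a character expansion: the even parts go into
  the trivial coefficient, the odd parts are the other coefficients.\<close>

lemma coset_sum_shift:
  fixes \<omega> :: "'a::euclidean_space"
  assumes "mask R" "g \<in> Gam"
  shows "coset_sum R (\<omega> + pi *\<^sub>R g) =
    1 / 2 ^ (DIM('a) - 1) * (1 - 2 ^ (DIM('a) - 1) + (\<Sum>\<nu>\<in>Gam'. even_part R (\<omega> \<bullet> \<nu>))) +
    (\<Sum>\<nu>\<in>Gam'. cube_char \<nu> g * (odd_part R (\<omega> \<bullet> \<nu>) / 2 ^ (DIM('a) - 1)))"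
proof -
  have "R ((\<omega> + pi *\<^sub>R g) \<bullet> \<nu>) = even_part R (\<omega> \<bullet> \<nu>) + cube_char \<nu> g * odd_part R (\<omega> \<bullet> \<nu>)"
    if "\<nu> \<in> Gam'" for \<nu>
    using mask_ridge_shift[OF assms(1) _ assms(2)] that by (simp add: Gam'_def)
  then have "(\<Sum>\<nu>\<in>Gam'. R ((\<omega> + pi *\<^sub>R g) \<bullet> \<nu>)) =
      (\<Sum>\<nu>\<in>Gam'. even_part R (\<omega> \<bullet> \<nu>)) + (\<Sum>\<nu>\<in>Gam'. cube_char \<nu> g * odd_part R (\<omega> \<bullet> \<nu>))"
    by (simp add: sum.distrib)
  then show ?thesis
    by (simp add: coset_sum_def sum_divide_distrib[symmetric] ring_distribs add_divide_distrib)
qed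

lemma mask_coset_sum:
  assumes "mask R"
  shows "mask (coset_sum R :: 'a::euclidean_space \<Rightarrow> complex)"
proof -
  have "mask (\<lambda>\<omega>. R (\<omega> \<bullet> \<nu>))" if "\<nu> \<in> Gam'" for \<nu> :: 'a
    using that mask_ridge[OF assms] Gam_subset_int_lattice by (auto simp: Gam'_def)
  then have "mask (\<lambda>\<omega>::'a. 1 / 2 ^ (DIM('a) - 1) *
      (1 - 2 ^ (DIM('a) - 1) + (\<Sum>\<nu>\<in>Gam'. R (\<omega> \<bullet> \<nu>))))"
    by (intro mask_mult mask_add mask_sum mask_const)
  then show ?thesis
    by (simp add: coset_sum_def[abs_def])
qed

text \<open>With \<open>N = 2 ^ (DIM('a) - 1)\<close> there are \<open>2 * N - 1\<close> summands,
  each 1 at the origin, so the value there is \<open>(1 - N + (2 * N - 1)) / N = 1\<close>.\<close>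

lemma refinement_mask_coset_sum:
  assumes "refinement_mask R"
  shows "refinement_mask (coset_sum R :: 'a::euclidean_space \<Rightarrow> complex)"
  using assms mask_coset_sum[of R]
  by (simp add: refinement_mask_def coset_sum_def card_Gam')

section \<open>Univariate identities for interpolatory and biorthogonal masks\<close>

lemma eq_of_eq_on_torus:
  fixes f :: "real \<Rightarrow> complex"
  assumes "mask f" "\<And>x. x \<in> torus \<Longrightarrow> f x = c"
  shows "f x = c"
proof -
  \<comment> \<open>The number of periods to subtract so that \<open>x\<close> lands in the interval
    from \<open>-pi\<close> to \<open>pi\<close>.\<close>
  define j where "j = \<lfloor>(x + pi) / (2 * pi)\<rfloor>"
  define y where "y = x - 2 * pi * of_int j"
  have "of_int j \<le> (x + pi) / (2 * pi)" "(x + pi) / (2 * pi) < of_int j + 1"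
    unfolding j_def by linarith+
  then have "y \<in> torus"
    by (auto simp: y_def torus_real field_simps)
  then have "f y = c"
    by (rule assms(2))
  moreover have "f x = f y"
    using mask_periodic_real[OF assms(1), of y j] by (simp add: y_def)
  ultimately show ?thesis
    by simp
qed

lemma interpolatory_shift:
  fixes U :: "real \<Rightarrow> complex"
  assumes "interpolatory U"
  shows "U (x + pi) = 1 - U x"
proof -
  have U: "mask U"
    using assms by (simp add: interpolatory_def refinement_mask_def)
  have "U x + U (x + pi) = 1"
  proof (rule eq_of_eq_on_torus[where f = "\<lambda>x. U x + U (x + pi)"])
    show "mask (\<lambda>x. U x + U (x + pi))"
      by (intro mask_add mask_shift U)
  qed (use assms in \<open>simp add: interpolatory_def Gam_real\<close>)
  then show ?thesis
    by (simp add: eq_diff_eq add.commute)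
qed

lemma interpolatory_even_part:
  fixes U :: "real \<Rightarrow> complex"
  assumes "interpolatory U"
  shows "even_part U x = 1 / 2"
  by (simp add: even_part_def interpolatory_shift[OF assms])

text \<open>In even and odd parts, biorthogonality says that twice the sum of the even-even and the
  odd-odd product is 1, and the even part of \<open>U\<close> is \<open>1 / 2\<close>.\<close>

lemma biorthogonal_even_part:
  fixes S U :: "real \<Rightarrow> complex"
  assumes "biorthogonal S U" "interpolatory U"
  shows "cnj (even_part S x) = 1 - 2 * cnj (odd_part S x) * odd_part U x"
proof -
  have SU: "mask S" "mask U"
    using assms by (simp_all add: biorthogonal_def refinement_mask_def)
  have bi: "cnj (S x) * U x + cnj (S (x + pi)) * U (x + pi) = 1"
  proof (rule eq_of_eq_on_torus[where f = "\<lambda>x. cnj (S x) * U x + cnj (S (x + pi)) * U (x + pi)"])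
    show "mask (\<lambda>x. cnj (S x) * U x + cnj (S (x + pi)) * U (x + pi))"
      by (intro mask_add mask_mult mask_cnj mask_shift SU)
  qed (use assms in \<open>simp add: biorthogonal_def Gam_real\<close>)
  have "cnj (even_part S x) - (1 - 2 * cnj (odd_part S x) * odd_part U x) =
      cnj (S x) * U x + cnj (S (x + pi)) * U (x + pi) - 1"
    unfolding odd_part_def even_part_def interpolatory_shift[OF assms(2)]
    by (simp add: field_simps)
  then show ?thesis
    using bi by simp
qed

section \<open>Character expansions and biorthogonality of the coset sums\<close>

text \<open>With \<open>N = 2 ^ (DIM('a) - 1)\<close>, the \<open>2 * N - 1\<close> even parts equal
  to \<open>1 / 2\<close> reduce the trivial coefficient to
  \<open>(1 - N + (2 * N - 1) / 2) / N = 1 / (2 * N)\<close>.\<close>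

lemma coset_sum_shift_dual:
  fixes \<omega> :: "'a::euclidean_space"
  assumes "interpolatory U" "g \<in> Gam"
  shows "coset_sum U (\<omega> + pi *\<^sub>R g) =
    1 / 2 ^ DIM('a) + (\<Sum>\<nu>\<in>Gam'. cube_char \<nu> g * (odd_part U (\<omega> \<bullet> \<nu>) / 2 ^ (DIM('a) - 1)))"
proof -
  have "mask U"
    using assms(1) by (simp add: interpolatory_def refinement_mask_def)
  from coset_sum_shift[OF this assms(2)] show ?thesis
    by (simp add: interpolatory_even_part[OF assms(1)] card_Gam' two_power_DIM[where 'a='a] field_simps)
qed

lemma cnj_coset_sum_shift_primal:
  fixes \<omega> :: "'a::euclidean_space"
  assumes "biorthogonal S U" "interpolatory U" "g \<in> Gam"
  defines "N \<equiv> 2 ^ (DIM('a) - 1)"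
  shows "cnj (coset_sum S (\<omega> + pi *\<^sub>R g)) =
    1 - 2 / N * (\<Sum>\<nu>\<in>Gam'. cnj (odd_part S (\<omega> \<bullet> \<nu>)) * odd_part U (\<omega> \<bullet> \<nu>)) +
    (\<Sum>\<nu>\<in>Gam'. cube_char \<nu> g * (cnj (odd_part S (\<omega> \<bullet> \<nu>)) / N))"
proof -
  have "mask S"
    using assms(1) by (simp add: biorthogonal_def refinement_mask_def)
  have N: "N \<noteq> 0" "cnj N = N"
    by (simp_all add: N_def)
  have char: "cnj (cube_char \<nu> g) = cube_char \<nu> g" for \<nu>
    by (simp add: cube_char_def)
  have "(\<Sum>\<nu>\<in>Gam'. cnj (even_part S (\<omega> \<bullet> \<nu>))) =
      (2 * N - 1) - 2 * (\<Sum>\<nu>\<in>Gam'. cnj (odd_part S (\<omega> \<bullet> \<nu>)) * odd_part U (\<omega> \<bullet> \<nu>))"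
    by (simp add: biorthogonal_even_part[OF assms(1,2)] sum_subtractf card_Gam' N_def
        sum_distrib_left mult.assoc)
  then show ?thesis
    unfolding coset_sum_shift[OF \<open>mask S\<close> assms(3)] N_def[symmetric]
    using N by (simp add: char field_simps)
qed

text \<open>In Parseval's identity the products of odd parts from the nontrivial characters cancel
  against the correction in the trivial coefficient of the primal mask.\<close>

lemma biorthogonal_coset_sum:
  assumes "biorthogonal S U" "interpolatory U"
  shows "biorthogonal (coset_sum S :: 'a::euclidean_space \<Rightarrow> complex) (coset_sum U)"
proof -
  define N :: complex where "N = 2 ^ (DIM('a) - 1)"
  have N: "N \<noteq> 0" "2 ^ DIM('a) = 2 * N"
    by (simp_all add: N_def two_power_DIM)
  have "(\<Sum>\<gamma>\<in>(*\<^sub>R) pi ` Gam. cnj (coset_sum S (\<omega> + \<gamma>)) * coset_sum U (\<omega> + \<gamma>)) = 1"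
    for \<omega> :: 'a
  proof -
    define a where "a \<nu> = cnj (odd_part S (\<omega> \<bullet> \<nu>))" for \<nu>
    define u where "u \<nu> = odd_part U (\<omega> \<bullet> \<nu>)" for \<nu>
    have "(\<Sum>\<gamma>\<in>(*\<^sub>R) pi ` Gam. cnj (coset_sum S (\<omega> + \<gamma>)) * coset_sum U (\<omega> + \<gamma>)) =
        (\<Sum>g\<in>Gam. cnj (coset_sum S (\<omega> + pi *\<^sub>R g)) * coset_sum U (\<omega> + pi *\<^sub>R g))"
      by (subst sum.reindex) (auto intro: inj_onI)
    also have "\<dots> = (\<Sum>g\<in>Gam.
        (1 - 2 / N * (\<Sum>\<nu>\<in>Gam'. a \<nu> * u \<nu>) + (\<Sum>\<nu>\<in>Gam'. cube_char \<nu> g * (a \<nu> / N))) *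
        (1 / (2 * N) + (\<Sum>\<nu>\<in>Gam'. cube_char \<nu> g * (u \<nu> / N))))"
      by (intro sum.cong refl)
        (simp only: cnj_coset_sum_shift_primal[OF assms] coset_sum_shift_dual[OF assms(2)]
          N(2) a_def u_def N_def[symmetric])
    also have "\<dots> = 2 * N * ((1 - 2 / N * (\<Sum>\<nu>\<in>Gam'. a \<nu> * u \<nu>)) * (1 / (2 * N)) +
        (\<Sum>\<nu>\<in>Gam'. (a \<nu> / N) * (u \<nu> / N)))"
      by (simp only: parseval_cube_split N(2))
    also have "(\<Sum>\<nu>\<in>Gam'. (a \<nu> / N) * (u \<nu> / N)) = (\<Sum>\<nu>\<in>Gam'. a \<nu> * u \<nu>) / (N * N)"
      by (simp add: sum_divide_distrib)
    also have "2 * N * ((1 - 2 / N * (\<Sum>\<nu>\<in>Gam'. a \<nu> * u \<nu>)) * (1 / (2 * N)) +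
        (\<Sum>\<nu>\<in>Gam'. a \<nu> * u \<nu>) / (N * N)) = 1"
      using N(1) by (simp add: field_simps)
    finally show ?thesis .
  qed
  then show ?thesis
    using assms(1) by (simp add: biorthogonal_def refinement_mask_coset_sum)
qed

section \<open>The mixed extension principle\<close>

text \<open>The point \<open>\<omega>\<close> is fixed, so each \<open>td \<nu>\<close> is a number,
  whereas \<open>t\<close> must be known at the shifted point too. All terms involving
  \<open>S\<close> cancel, and what remains is the normalised sum of all characters at
  \<open>g\<close>.\<close>

lemma mixed_extension_coset_sum:
  fixes S U :: "real \<Rightarrow> complex" and \<omega> g :: "'a::euclidean_space"
  assumes "biorthogonal S U" "interpolatory U" "g \<in> Gam"
    and t: "\<And>\<nu> \<omega>. \<nu> \<in> Gam' \<Longrightarrow>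
      t \<nu> \<omega> = exp (- \<i> * complex_of_real (\<omega> \<bullet> \<nu>)) * cnj (U (\<omega> \<bullet> \<nu> + pi))"
    and td: "\<And>\<nu>. \<nu> \<in> Gam' \<Longrightarrow> td \<nu> = 1 / 2 ^ (DIM('a) - 1) *
      (exp (- \<i> * complex_of_real (\<omega> \<bullet> \<nu>)) *
        (1 - 2 * cnj (odd_part S (\<omega> \<bullet> \<nu>)) * coset_sum U \<omega>))"
  shows "cnj (coset_sum S (\<omega> + pi *\<^sub>R g)) * coset_sum U \<omega> +
    (\<Sum>\<nu>\<in>Gam'. cnj (t \<nu> (\<omega> + pi *\<^sub>R g)) * td \<nu>) = (if g = 0 then 1 else 0)"
proof -
  define N :: complex where "N = 2 ^ (DIM('a) - 1)"
  have N: "N \<noteq> 0" "2 ^ DIM('a) = 2 * N"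
    by (simp_all add: N_def two_power_DIM)
  have U: "mask U"
    using assms(2) by (simp add: interpolatory_def refinement_mask_def)
  define a where "a \<nu> = cnj (odd_part S (\<omega> \<bullet> \<nu>))" for \<nu>
  define u where "u \<nu> = odd_part U (\<omega> \<bullet> \<nu>)" for \<nu>
  define T where "T = (coset_sum U \<omega> :: complex)"
  have T: "T = 1 / (2 * N) + (\<Sum>\<nu>\<in>Gam'. u \<nu>) / N"
    using coset_sum_shift_dual[OF assms(2) zero_in_Gam, of \<omega>]
    by (simp add: T_def u_def cube_char_commute[of _ 0] cube_char_zero N(2)
        N_def sum_divide_distrib)
  have prod: "cnj (t \<nu> (\<omega> + pi *\<^sub>R g)) * td \<nu> =
      (cube_char \<nu> g / 2 - u \<nu>) * (1 - 2 * a \<nu> * T) / N" if \<nu>: "\<nu> \<in> Gam'" for \<nu>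
  proof -
    define e where "e = exp (- \<i> * complex_of_real (\<omega> \<bullet> \<nu>))"
    have \<nu>': "\<nu> \<in> Gam"
      using \<nu> by (simp add: Gam'_def)
    have "exp (- \<i> * complex_of_real ((\<omega> + pi *\<^sub>R g) \<bullet> \<nu>)) = e * cube_char \<nu> g"
    proof -
      have "g \<bullet> \<nu> \<in> \<int>"
        using \<nu>' assms(3) inner_int_lattice Gam_subset_int_lattice by blast
      then obtain j where j: "g \<bullet> \<nu> = of_int j"
        by (auto elim: Ints_cases)
      \<comment> \<open>At an integer multiple of \<open>pi\<close> the sine vanishes, so the extra
        exponential factor is the character itself.\<close>
      have "exp (- \<i> * complex_of_real ((\<omega> + pi *\<^sub>R g) \<bullet> \<nu>)) = e * cis (- (pi * of_int j))"
        by (simp add: e_def cis_conv_exp exp_add[symmetric] inner_add_left j algebra_simps)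
      also have "cis (- (pi * of_int j)) = cube_char \<nu> g"
        by (simp add: complex_eq_iff cube_char_def inner_commute[of \<nu>] j)
      finally show ?thesis .
    qed
    moreover have "U ((\<omega> + pi *\<^sub>R g) \<bullet> \<nu> + pi) = 1 / 2 - cube_char \<nu> g * u \<nu>"
    proof -
      have "U ((\<omega> + pi *\<^sub>R g) \<bullet> \<nu>) = 1 / 2 + cube_char \<nu> g * u \<nu>"
        using mask_ridge_shift[OF U \<nu>' assms(3)]
        by (simp add: interpolatory_even_part[OF assms(2)] u_def)
      then show ?thesis
        by (simp add: interpolatory_shift[OF assms(2)])
    qed
    ultimately have "cnj (t \<nu> (\<omega> + pi *\<^sub>R g)) =
        cnj e * cube_char \<nu> g * (1 / 2 - cube_char \<nu> g * u \<nu>)"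
      unfolding t[OF \<nu>] by (simp add: cube_char_def)
    \<comment> \<open>The character squares to 1, which moves it from \<open>u \<nu>\<close> to the
      constant \<open>1 / 2\<close>.\<close>
    also have "\<dots> = cnj e * (cube_char \<nu> g / 2 - u \<nu>)"
      using cube_char_square[OF \<nu>' assms(3)] by algebra
    finally have t_eq: "cnj (t \<nu> (\<omega> + pi *\<^sub>R g)) = cnj e * (cube_char \<nu> g / 2 - u \<nu>)" .
    have "cnj e * e = 1"
      by (simp add: e_def exp_cnj exp_add[symmetric])
    moreover have "td \<nu> = e * (1 - 2 * a \<nu> * T) / N"
      using td[OF \<nu>] by (simp add: e_def a_def T_def N_def)
    ultimately show ?thesis
      unfolding t_eq by (simp add: mult_ac)
  qed
  define P where "P = (\<Sum>\<nu>\<in>Gam'. a \<nu> * u \<nu>)"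
  define A where "A = (\<Sum>\<nu>\<in>Gam'. cube_char \<nu> g * a \<nu>)"
  define X where "X = (\<Sum>\<nu>\<in>Gam'. cube_char \<nu> g)"
  define V where "V = (\<Sum>\<nu>\<in>Gam'. u \<nu>)"
  have "(\<Sum>\<nu>\<in>Gam'. (cube_char \<nu> g / 2 - u \<nu>) * (1 - 2 * a \<nu> * T) / N) =
      (\<Sum>\<nu>\<in>Gam'. cube_char \<nu> g * (1 / (2 * N)) - u \<nu> * (1 / N)
        - (cube_char \<nu> g * a \<nu>) * (T / N) + (a \<nu> * u \<nu>) * (2 * T / N))"
    by (intro sum.cong refl) (simp add: N(1) field_simps)
  also have "\<dots> = X * (1 / (2 * N)) - V * (1 / N) - A * (T / N) + P * (2 * T / N)"
    by (simp only: sum.distrib sum_subtractf sum_distrib_right P_def A_def X_def V_def)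
  finally have "(\<Sum>\<nu>\<in>Gam'. cnj (t \<nu> (\<omega> + pi *\<^sub>R g)) * td \<nu>) =
      X * (1 / (2 * N)) - V * (1 / N) - A * (T / N) + P * (2 * T / N)"
    using prod by simp
  moreover have "cnj (coset_sum S (\<omega> + pi *\<^sub>R g)) = 1 - 2 / N * P + A / N"
    using cnj_coset_sum_shift_primal[OF assms(1-3), of \<omega>]
    by (simp add: a_def u_def N_def A_def P_def sum_divide_distrib)
  \<comment> \<open>The terms \<open>A * T / N\<close> and \<open>2 * P * T / N\<close> occur with
    both signs: the dual wavelet masks are chosen for this cancellation.\<close>
  moreover have "(1 - 2 / N * P + A / N) * T +
      (X * (1 / (2 * N)) - V * (1 / N) - A * (T / N) + P * (2 * T / N)) = T - V / N + X / (2 * N)"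
    using N(1) by (simp add: field_simps)
  ultimately have "cnj (coset_sum S (\<omega> + pi *\<^sub>R g)) * coset_sum U \<omega> +
      (\<Sum>\<nu>\<in>Gam'. cnj (t \<nu> (\<omega> + pi *\<^sub>R g)) * td \<nu>) = T - V / N + X / (2 * N)"
    by (simp only: T_def[symmetric])
  \<comment> \<open>Subtracting \<open>V / N\<close> from the expansion of \<open>T\<close> leaves
    its trivial coefficient \<open>1 / (2 * N)\<close>.\<close>
  also have "\<dots> = (1 + X) / (2 * N)"
    by (simp add: T V_def add_divide_distrib)
  also have "\<dots> = (if g = 0 then 1 else 0)"
    using sum_cube_char[OF assms(3)] N by (simp add: X_def)
  finally show ?thesis .
qed

theorem theorem2:
  fixes S U :: "real \<Rightarrow> complex"
    and \<tau> \<tau>d :: "real ^ 'n \<Rightarrow> complex"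
    and t :: "real ^ 'n \<Rightarrow> real ^ 'n \<Rightarrow> complex"
  assumes "biorthogonal S U"
    and "1 \<le> accuracy_number S" and "1 \<le> accuracy_number U"
    and "interpolatory U"
    and "\<tau> = coset_sum S" and "\<tau>d = coset_sum U"
    and "\<And>\<nu> \<omega>. \<nu> \<in> Gam' \<Longrightarrow>
           t \<nu> \<omega> = exp (- \<i> * complex_of_real (\<omega> \<bullet> \<nu>)) * cnj (U (\<omega> \<bullet> \<nu> + pi))"
  shows "\<exists>td. combined_biorthogonal_masks \<tau> t \<tau>d td"
proof -
  let ?N = "2 ^ (DIM(real ^ 'n) - 1) :: complex"
  \<comment> \<open>The factor \<open>2 * cnj (odd_part S (\<omega> \<bullet> \<nu>))\<close> is the
    difference of the conjugated values of \<open>S\<close> at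
    \<open>\<omega> \<bullet> \<nu>\<close> and at its shift by \<open>pi\<close>.\<close>
  define td :: "real ^ 'n \<Rightarrow> real ^ 'n \<Rightarrow> complex" where
    "td \<nu> \<omega> = 1 / ?N * (exp (- \<i> * complex_of_real (\<omega> \<bullet> \<nu>)) *
        (1 - 2 * cnj (odd_part S (\<omega> \<bullet> \<nu>)) * coset_sum U \<omega>))" for \<nu> \<omega>
  have S: "mask S" and U: "mask U"
    using assms(1) by (simp_all add: biorthogonal_def refinement_mask_def)
  have "mask (t \<nu>) \<and> mask (td \<nu>)" if \<nu>: "\<nu> \<in> Gam'" for \<nu>
  proof
    have lattice: "\<nu> \<in> int_lattice"
      using \<nu> Gam_subset_int_lattice by (auto simp: Gam'_def)
    have e: "mask (\<lambda>\<omega>. exp (- \<i> * complex_of_real (\<omega> \<bullet> \<nu>)))"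
      using mask_monomial[OF lattice, of 1] by (simp add: inner_commute)
    have "mask (\<lambda>\<omega>. cnj (U (\<omega> \<bullet> \<nu> + pi)))"
      using mask_cnj[OF mask_ridge[OF mask_shift[OF U] lattice]] .
    moreover have "t \<nu> = (\<lambda>\<omega>. exp (- \<i> * complex_of_real (\<omega> \<bullet> \<nu>)) * cnj (U (\<omega> \<bullet> \<nu> + pi)))"
      using assms(7)[OF \<nu>] by blast
    ultimately show "mask (t \<nu>)"
      using mask_mult[OF e] by simp
    have "mask (\<lambda>x. 1 / 2 * (S x - S (x + pi)))"
      by (intro mask_mult mask_diff mask_const mask_shift S)
    then have "mask (odd_part S)"
      by (simp add: odd_part_def[abs_def])
    then have "mask (\<lambda>\<omega>. cnj (odd_part S (\<omega> \<bullet> \<nu>)))"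
      by (intro mask_cnj mask_ridge lattice)
    then show "mask (td \<nu>)"
      unfolding td_def[abs_def] by (intro mask_mult mask_diff mask_const e mask_coset_sum U)
  qed
  moreover have "cnj (\<tau> (\<omega> + \<gamma>)) * \<tau>d \<omega> + (\<Sum>\<nu>\<in>Gam'. cnj (t \<nu> (\<omega> + \<gamma>)) * td \<nu> \<omega>)
      = (if \<gamma> = 0 then 1 else 0)" if \<gamma>: "\<gamma> \<in> (*\<^sub>R) pi ` Gam" for \<omega> \<gamma>
  proof -
    obtain g where g: "g \<in> Gam" "\<gamma> = pi *\<^sub>R g"
      using \<gamma> by blast
    show ?thesis
      using mixed_extension_coset_sum[OF assms(1,4) g(1) assms(7), of "\<lambda>\<nu>. td \<nu> \<omega>" \<omega>]
      by (simp add: td_def g(2) assms(5,6))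
  qed
  ultimately have "combined_biorthogonal_masks \<tau> t \<tau>d td"
    using biorthogonal_coset_sum[OF assms(1,4)]
    by (simp add: combined_biorthogonal_masks_def assms(5,6))
  then show ?thesis
    by blast
qed

end
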